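(* Let $r\ge1$, let $p_1,\dots,p_r\ge5$ be distinct primes, $P=p_1\cdots p_r$ and $M=6P$. For every positive integer $n$, $$\frac{\kappa_P(n)}{M}=\left(\frac{\varphi(M)}{M}\right)^2\mathfrak S_M^{\mathrm{fin}}(2n).$$ Equivalently, since $M=6P$, $$\frac{\kappa_P(n)}{6P}=\left(\frac{\varphi(6P)}{6P}\right)^2\mathfrak S_{6P}^{\mathrm{fin}}(2n).$$
   Context: $\varphi$ is Euler's totient function. For $q\in\mathbb Z_{>0}$, $x\in\mathbb Z$, $\delta_q(x)=x-q\lfloor x/q\rfloor$. $\mathbf 1_{\{\cdot\}}$ denotes an indicator. With $\varepsilon_i(n)=\mathbf 1_{\{\delta_{p_i}(n)=0\}}$, $$\kappa_P(n)=\bigl(1+\mathbf 1_{\{\delta_3(n)=0\}}\bigr)\prod_{i=1}^r\bigl(p_i-2+\varepsilon_i(n)\bigr).$$ For each prime $q\mid M$, $\nu_q(2n)=2-\mathbf 1_{\{\delta_q(2n)=0\}}$, and $$\mathfrak S_M^{\mathrm{fin}}(2n)=\prod_{q\mid M}\frac{1-\nu_q(2n)/q}{(1-1/q)^2},$$ the product being over the primes $q$ dividing $M$. *)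

theory Defs
  imports Complex_Main "HOL-Number_Theory.Number_Theory"
begin

definition delta :: "nat \<Rightarrow> int \<Rightarrow> int" where
  "delta q x = x - int q * \<lfloor>real_of_int x / real q\<rfloor>"

definition eps :: "nat \<Rightarrow> int \<Rightarrow> int" where
  "eps q n = of_bool (delta q n = 0)"

(* kappa_P for P = p 1 * ... * p r; integer-valued, so that p i - 2 is not truncated. *)
definition kappa :: "nat \<Rightarrow> (nat \<Rightarrow> nat) \<Rightarrow> int \<Rightarrow> int" where
  "kappa r p n = (1 + of_bool (delta 3 n = 0)) * (\<Prod>i = 1..r. (int (p i) - 2 + eps (p i) n))"

definition nu :: "nat \<Rightarrow> int \<Rightarrow> int" where
  "nu q x = 2 - of_bool (delta q x = 0)"

(* The finite singular series at x; for M = 0 the index set is infinite and the product is 1. *)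
definition singular_fin :: "nat \<Rightarrow> int \<Rightarrow> real" where
  "singular_fin M x =
     (\<Prod>q | prime q \<and> q dvd M. (1 - real_of_int (nu q x) / real q) / (1 - 1 / real q)\<^sup>2)"

end

theory Submission
  imports Defs
begin

text \<open>By Euler's product, \<open>totient M / M\<close> is the product of 1 - 1/q over the
  primes q dividing M, so its square cancels the denominators of the singular series
  (\<open>totient_density_sq_mult_singular_fin\<close>). What remains is the product of the local
  densities 1 - nu_q(2n)/q. The primes dividing M are 2, 3 and the distinct p_i. At 2 the density is
  1/2, since 2n is even. At an odd prime q, q divides 2n iff it divides n
  (\<open>delta_double_eq_0_iff\<close>), so the density is (q - 2 + eps_q(n))/q. The numerators
  multiply to \<open>kappa\<close> and the denominators to 2 * 3 * P = M.\<close>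

lemma delta_eq_mod: "delta q x = x mod int q"
proof -
  have "\<lfloor>real_of_int x / real q\<rfloor> = x div int q"
    using floor_divide_of_int_eq [of x "int q", where ?'a = real] by simp
  then show ?thesis
    by (simp add: delta_def minus_mult_div_eq_mod)
qed

lemma delta_eq_0_iff: "delta q x = 0 \<longleftrightarrow> int q dvd x"
  by (simp add: delta_eq_mod dvd_eq_mod_eq_0)

text \<open>2 is invertible modulo an odd prime. This links the indicators in \<open>nu\<close>,
  taken at 2n, with those in \<open>kappa\<close>, taken at n.\<close>

lemma delta_double_eq_0_iff:
  assumes "prime q" "q \<noteq> 2"
  shows "delta q (2 * n) = 0 \<longleftrightarrow> delta q n = 0"
proof -
  have "coprime q 2"
    using assms primes_coprime two_is_prime_nat by blast
  then have "coprime (int q) 2"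
    by (metis coprime_int_iff of_nat_numeral)
  then show ?thesis
    by (simp add: delta_eq_0_iff coprime_dvd_mult_right_iff)
qed

lemma totient_density_sq_mult_singular_fin:
  assumes "M > 0"
  shows "(real (totient M) / real M)\<^sup>2 * singular_fin M x =
    (\<Prod>q | prime q \<and> q dvd M. 1 - real_of_int (nu q x) / real q)"
proof -
  have S: "{q. prime q \<and> q dvd M} = prime_factors M"
    using assms by (auto simp: in_prime_factors_iff)
  have "real (totient M) / real M = (\<Prod>q | prime q \<and> q dvd M. 1 - 1 / real q)"
    using assms by (simp add: totient_formula2 S)
  then have "(real (totient M) / real M)\<^sup>2 * singular_fin M x =
    (\<Prod>q | prime q \<and> q dvd M. (1 - 1 / real q)\<^sup>2 *
      ((1 - real_of_int (nu q x) / real q) / (1 - 1 / real q)\<^sup>2))"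
    by (simp only: singular_fin_def prod_power_distrib prod.distrib)
  also have "\<dots> = (\<Prod>q | prime q \<and> q dvd M. 1 - real_of_int (nu q x) / real q)"
  proof (intro prod.cong refl)
    \<comment> \<open>The cancellation is legitimate because 1 - 1/q vanishes only at q = 1, which
      is not prime.\<close>
    fix q assume "q \<in> {q. prime q \<and> q dvd M}"
    then have "real q \<noteq> 1" by auto
    then have "1 - 1 / real q \<noteq> 0" by simp
    then show "(1 - 1 / real q)\<^sup>2 * ((1 - real_of_int (nu q x) / real q) / (1 - 1 / real q)\<^sup>2) =
      1 - real_of_int (nu q x) / real q" by simp
  qed
  finally show ?thesis .
qed

theorem corollary4p2:
  fixes r P M :: nat and p :: "nat \<Rightarrow> nat" and n :: int
  assumes "r \<ge> 1"
    and "\<And>i. i \<in> {1..r} \<Longrightarrow> prime (p i)"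
    and "\<And>i. i \<in> {1..r} \<Longrightarrow> p i \<ge> 5"
    and "inj_on p {1..r}"
    and "P = (\<Prod>i = 1..r. p i)"
    and "M = 6 * P"
    and "n > 0"
  shows "real_of_int (kappa r p n) / real M
           = (real (totient M) / real M)\<^sup>2 * singular_fin M (2 * n)
       \<and> real_of_int (kappa r p n) / real (6 * P)
           = (real (totient (6 * P)) / real (6 * P))\<^sup>2 * singular_fin (6 * P) (2 * n)"
proof -
  let ?f = "\<lambda>q. 1 - real_of_int (nu q (2 * n)) / real q"
  have "M > 0"
    using assms(2,5,6) by (auto intro!: prod_pos prime_gt_0_nat)
  have primes: "{q. prime q \<and> q dvd M} = {2, 3} \<union> p ` {1..r}"
  proof -
    have "q dvd M \<longleftrightarrow> q = 2 \<or> q = 3 \<or> q \<in> p ` {1..r}" if "prime q" for q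
    proof -
      have M: "M = 2 * 3 * (\<Prod>i = 1..r. p i)"
        using assms(5,6) by simp
      have "q dvd M \<longleftrightarrow> q dvd 2 \<or> q dvd 3 \<or> (\<exists>i\<in>{1..r}. q dvd p i)"
        unfolding M using that by (simp only: prime_dvd_mult_iff prime_dvd_prod_iff
          finite_atLeastAtMost disj_assoc)
      also have "\<dots> \<longleftrightarrow> q = 2 \<or> q = 3 \<or> (\<exists>i\<in>{1..r}. q = p i)"
      proof -
        have eq: "q dvd q' \<longleftrightarrow> q = q'" if "prime q'" for q' :: nat
          using primes_dvd_imp_eq [OF \<open>prime q\<close> that] by auto
        have "(\<exists>i\<in>{1..r}. q dvd p i) \<longleftrightarrow> (\<exists>i\<in>{1..r}. q = p i)"
          using assms(2) eq by blast
        then show ?thesis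
          using eq [of 2] eq [of 3] by simp
      qed
      finally show ?thesis by auto
    qed
    moreover have "prime (3 :: nat)" by simp
    ultimately show ?thesis
      using assms(2) by auto
  qed
  \<comment> \<open>The numerator is 3 - 2 plus the indicator, the first factor of
    \<open>kappa\<close>.\<close>
  have three: "?f 3 = (1 + of_bool (delta 3 n = 0)) / 3"
    using delta_double_eq_0_iff [of 3 n] by (simp add: nu_def)
  \<comment> \<open>2 always divides 2n, so \<open>nu\<close> is 1 here whatever n is.\<close>
  have two: "?f 2 = 1 / 2"
    by (simp add: nu_def delta_eq_0_iff)
  have large: "?f (p i) = real_of_int (int (p i) - 2 + eps (p i) n) / real (p i)"
    if "i \<in> {1..r}" for i
  proof -
    have "p i \<noteq> 0" "p i \<noteq> 2"
      using assms(3) [OF that] by auto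
    then show ?thesis
      using delta_double_eq_0_iff [of "p i" n] assms(2) [OF that]
      by (simp add: nu_def eps_def field_simps)
  qed
  \<comment> \<open>The bound p_i \<ge> 5 keeps the factors at 2 and 3 separate from the
    rest.\<close>
  have "2 \<notin> p ` {1..r}" "3 \<notin> p ` {1..r}"
    using assms(3) by fastforce+
  then have "(\<Prod>q | prime q \<and> q dvd M. ?f q) = ?f 2 * (?f 3 * prod ?f (p ` {1..r}))"
    unfolding primes by simp
  \<comment> \<open>Injectivity of \<open>p\<close> turns the product over the set of primes into
    one over indices.\<close>
  also have "prod ?f (p ` {1..r}) =
      (\<Prod>i = 1..r. real_of_int (int (p i) - 2 + eps (p i) n)) / real P"
    unfolding prod.reindex [OF assms(4)] o_def assms(5) of_nat_prod prod_dividef [symmetric]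
    using large by (rule prod.cong [OF refl])
  also have "?f 2 * (?f 3 * \<dots>) = real_of_int (kappa r p n) / real M"
    unfolding two three by (simp add: kappa_def assms(6))
  finally have "real_of_int (kappa r p n) / real M =
      (real (totient M) / real M)\<^sup>2 * singular_fin M (2 * n)"
    using totient_density_sq_mult_singular_fin [OF \<open>M > 0\<close>] by simp
  then show ?thesis
    using assms(6) by simp
qed

end
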